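(* Suppose that $\mathcal{N}=\mathcal{H}\sqcup\mathcal{K}$ (disjoint union). If $\theta_{ij}=0$ for all $i\in\mathcal{H}$, $j\in\mathcal{K}$, then the assortment optimization problem $\max_{S\subseteq\mathcal{N}}R(S)$ can be separated into assortment optimization problems for product sets $\mathcal{H}$ and $\mathcal{K}$.
   Context: Let $\mathcal{N}=\{1,\dots,n\}$ be a set of products and $\theta\in\mathbb{S}^n$ a real symmetric $n\times n$ matrix. An assortment is a subset $S\subseteq\mathcal{N}$; a basket from $S$ is a vector $x\in\mathcal{X}(S)=\{0,1\}^{S}$, where $x_i=1$ means that product $i$ is in the basket. Under the (binary) Ising model with parameters $\theta$, the probability that a random customer offered $S$ selects basket $x$ is $$p_\theta(x\mid S)=\frac{\exp\bigl(\sum_{i\in S}\theta_{ii}x_i+\sum_{i\ne j,\ i,j\in S}x_i\theta_{ij}x_j\bigr)}{\sum_{y\in\mathcal{X}(S)}\exp\bigl(\sum_{i\in S}\theta_{ii}y_i+\sum_{i\ne j,\ i,j\in S}y_i\theta_{ij}y_j\bigr)},$$ where the sum over $i\ne j$ runs over ordered pairs. Let $r_j$ denote the gross profit (alternatively, the revenue) per unit of product $j\in\mathcal{N}$. The expected profit generated by a random customer given assortment $S$ is $R(S)=\sum_{x\in\mathcal{X}(S)}p_\theta(x\mid S)\sum_{j\in S}r_jx_j$. The assortment optimization problem for a product set $\mathcal{M}\subseteq\mathcal{N}$ is the problem of maximizing $R(S)$ over all assortments $S\subseteq\mathcal{M}$. *)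

theory Defs
  imports "HOL-Analysis.Analysis"
begin

text \<open>
  The products are the elements of the finite index type \<open>'n\<close>, so the full product set is
  \<open>UNIV\<close>. A basket from \<open>S\<close>, an element of \<open>{0,1}\<^sup>S\<close>, is an extensional function on \<open>S\<close>
  (fixed to \<open>undefined\<close> outside \<open>S\<close>), so that distinct baskets are distinct elements.
\<close>

definition baskets :: "'n set \<Rightarrow> ('n \<Rightarrow> real) set" where
  "baskets S = S \<rightarrow>\<^sub>E {0, 1}"

text \<open>The quadratic part runs over ordered pairs: each unordered pair contributes twice.\<close>

definition basket_utility :: "real^'n^'n \<Rightarrow> 'n set \<Rightarrow> ('n \<Rightarrow> real) \<Rightarrow> real" where
  "basket_utility \<theta> S x =
     (\<Sum>i\<in>S. \<theta> $ i $ i * x i) +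
     (\<Sum>(i, j)\<in>{(i, j). i \<in> S \<and> j \<in> S \<and> i \<noteq> j}. x i * \<theta> $ i $ j * x j)"

definition ising_prob :: "real^'n^'n \<Rightarrow> ('n \<Rightarrow> real) \<Rightarrow> 'n set \<Rightarrow> real" where
  "ising_prob \<theta> x S =
     exp (basket_utility \<theta> S x) / (\<Sum>y\<in>baskets S. exp (basket_utility \<theta> S y))"

definition expected_profit :: "real^'n^'n \<Rightarrow> ('n \<Rightarrow> real) \<Rightarrow> 'n set \<Rightarrow> real" where
  "expected_profit \<theta> r S =
     (\<Sum>x\<in>baskets S. ising_prob \<theta> x S * (\<Sum>j\<in>S. r j * x j))"

definition optimal_assortment :: "real^'n^'n \<Rightarrow> ('n \<Rightarrow> real) \<Rightarrow> 'n set \<Rightarrow> 'n set \<Rightarrow> bool" where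
  "optimal_assortment \<theta> r M S \<longleftrightarrow>
     is_arg_max (expected_profit \<theta> r) (\<lambda>T. T \<subseteq> M) S"

definition optimal_profit :: "real^'n^'n \<Rightarrow> ('n \<Rightarrow> real) \<Rightarrow> 'n set \<Rightarrow> real" where
  "optimal_profit \<theta> r M = Max (expected_profit \<theta> r ` Pow M)"

end

theory Submission
  imports Defs
begin

text \<open>
  When no product of \<open>A\<close> interacts with a product of \<open>B\<close>, the utility of a basket from
  \<open>A \<union> B\<close> is the utility of its \<open>A\<close>-part plus that of its \<open>B\<close>-part
  (\<open>basket_utility_union\<close>).  The weight \<open>exp (utility)\<close> is then a product, so the choices made
  within \<open>A\<close> and within \<open>B\<close> are independent, and the law of each part is the law of a customer
  who is offered that part alone.  By linearity of expectation the profits add up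
  (\<open>expected_profit_union\<close>).

  Hence the profit of any assortment \<open>S\<close> is the sum of the profits of \<open>S \<inter> H\<close> and \<open>S \<inter> K\<close>.
  These two pieces range over the subsets of \<open>H\<close> and of \<open>K\<close> independently of each other, and a
  sum of two terms in independent variables is maximal exactly when both terms are
  (\<open>is_arg_max_additive_iff\<close>).
\<close>

lemma bij_betw_restrict_baskets_union:
  assumes "A \<inter> B = {}"
  shows "bij_betw (\<lambda>x. (restrict x A, restrict x B)) (baskets (A \<union> B)) (baskets A \<times> baskets B)"
  using assms
  by (intro bij_betw_byWitness[where f' = "\<lambda>(a, b). merge A B (a, b)"])
    (auto simp: baskets_def PiE_cancel_merge extensional_restrict PiE_def extensional_merge
      restrict_Pi_cancel)

lemma sum_mult_baskets_union:
  fixes f g :: "('n \<Rightarrow> real) \<Rightarrow> real"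
  assumes "A \<inter> B = {}"
  shows "(\<Sum>x\<in>baskets (A \<union> B). f (restrict x A) * g (restrict x B)) =
    (\<Sum>a\<in>baskets A. f a) * (\<Sum>b\<in>baskets B. g b)"
  using sum.reindex_bij_betw[OF bij_betw_restrict_baskets_union[OF assms],
      of "\<lambda>(a, b). f a * g b"]
  by (simp add: sum_product sum.cartesian_product)

lemma finite_baskets:
  fixes S :: "'n::finite set"
  shows "finite (baskets S)"
  unfolding baskets_def by (intro finite_PiE) auto

lemma partition_function_pos:
  fixes \<theta> :: "real^'n^'n"
  shows "0 < (\<Sum>y\<in>baskets S. exp (basket_utility \<theta> S y))"
proof -
  have "(\<lambda>i\<in>S. 0) \<in> baskets S"
    by (simp add: baskets_def)
  then show ?thesis
    by (intro sum_pos) (auto simp: finite_baskets)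
qed

lemma basket_utility_restrict:
  "basket_utility \<theta> S (restrict x S) = basket_utility \<theta> S x"
  unfolding basket_utility_def by (intro arg_cong2[where f = "(+)"] sum.cong) auto

text \<open>
  The ordered pairs of distinct products of \<open>A \<union> B\<close> are those inside \<open>A\<close>, those inside \<open>B\<close> and
  the mixed ones.  A mixed pair occurs in both orders, so its contribution involves both
  off-diagonal blocks of \<open>\<theta>\<close>.
\<close>

lemma basket_utility_union:
  fixes \<theta> :: "real^'n^'n"
  assumes disj: "A \<inter> B = {}"
    and AB: "\<And>i j. i \<in> A \<Longrightarrow> j \<in> B \<Longrightarrow> \<theta> $ i $ j = 0"
    and BA: "\<And>i j. i \<in> A \<Longrightarrow> j \<in> B \<Longrightarrow> \<theta> $ j $ i = 0"
  shows "basket_utility \<theta> (A \<union> B) x = basket_utility \<theta> A x + basket_utility \<theta> B x"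
proof -
  let ?P = "\<lambda>S. {(i, j). i \<in> S \<and> j \<in> S \<and> i \<noteq> j}"
  let ?q = "\<lambda>(i, j). x i * \<theta> $ i $ j * x j"
  have "sum ?q (?P (A \<union> B)) = sum ?q (?P A \<union> ?P B)"
    by (rule sum.mono_neutral_right) (auto simp: AB BA)
  also have "\<dots> = sum ?q (?P A) + sum ?q (?P B)"
    using disj by (intro sum.union_disjoint) auto
  finally show ?thesis
    using disj by (simp add: basket_utility_def sum.union_disjoint)
qed

lemma expected_profit_eq_quotient:
  "expected_profit \<theta> r S =
    (\<Sum>x\<in>baskets S. exp (basket_utility \<theta> S x) * (\<Sum>j\<in>S. r j * x j)) /
    (\<Sum>x\<in>baskets S. exp (basket_utility \<theta> S x))"
  by (simp add: expected_profit_def ising_prob_def sum_divide_distrib)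

text \<open>
  Writing \<open>Z\<close> for the partition function and \<open>N\<close> for the weighted profit sum, the profit is
  \<open>N / Z\<close>.  Factorization of the weights gives \<open>Z (A \<union> B) = Z A * Z B\<close> and
  \<open>N (A \<union> B) = N A * Z B + Z A * N B\<close>, whose quotient is \<open>N A / Z A + N B / Z B\<close>.
\<close>

lemma expected_profit_union:
  fixes \<theta> :: "real^'n^'n" and r :: "'n \<Rightarrow> real"
  assumes disj: "A \<inter> B = {}"
    and AB: "\<And>i j. i \<in> A \<Longrightarrow> j \<in> B \<Longrightarrow> \<theta> $ i $ j = 0"
    and BA: "\<And>i j. i \<in> A \<Longrightarrow> j \<in> B \<Longrightarrow> \<theta> $ j $ i = 0"
  shows "expected_profit \<theta> r (A \<union> B) = expected_profit \<theta> r A + expected_profit \<theta> r B"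
proof -
  define w where "w S x = exp (basket_utility \<theta> S x)" for S x
  define g where "g S x = (\<Sum>j\<in>S. r j * x j)" for S and x :: "'n \<Rightarrow> real"
  define Z where "Z S = (\<Sum>x\<in>baskets S. w S x)" for S
  define N where "N S = (\<Sum>x\<in>baskets S. w S x * g S x)" for S
  have profit: "expected_profit \<theta> r S = N S / Z S" for S
    by (simp add: expected_profit_eq_quotient N_def Z_def w_def g_def)
  have Z_pos: "0 < Z S" for S
    unfolding Z_def w_def by (rule partition_function_pos)
  have w: "w (A \<union> B) x = w A (restrict x A) * w B (restrict x B)" for x
    by (simp add: w_def basket_utility_union[OF disj AB BA] basket_utility_restrict exp_add)
  have g: "g (A \<union> B) x = g A (restrict x A) + g B (restrict x B)" for x
    using disj by (simp add: g_def sum.union_disjoint)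
  have Z: "Z (A \<union> B) = Z A * Z B"
    by (simp add: Z_def w sum_mult_baskets_union[OF disj])
  have "N (A \<union> B) =
    (\<Sum>x\<in>baskets (A \<union> B). (w A (restrict x A) * g A (restrict x A)) * w B (restrict x B)) +
    (\<Sum>x\<in>baskets (A \<union> B). w A (restrict x A) * (w B (restrict x B) * g B (restrict x B)))"
    by (simp add: N_def w g sum.distrib[symmetric] algebra_simps)
  also have "\<dots> = N A * Z B + Z A * N B"
    by (simp add: N_def Z_def sum_mult_baskets_union[OF disj, of "\<lambda>x. w A x * g A x"]
        sum_mult_baskets_union[OF disj, of _ "\<lambda>x. w B x * g B x"])
  finally show ?thesis
    using Z_pos[of A] Z_pos[of B] by (simp add: profit Z field_simps)
qed

text \<open>
  If one piece of \<open>S\<close> could be improved, exchanging that piece alone would improve \<open>S\<close>, because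
  disjointness of \<open>H\<close> and \<open>K\<close> leaves the other piece as it is.
  Conversely, adding the two bounds for the pieces gives the bound for \<open>S\<close>.
\<close>

lemma is_arg_max_additive_iff:
  fixes f :: "'a set \<Rightarrow> 'b::linordered_ab_group_add"
  assumes disj: "H \<inter> K = {}"
    and add: "\<And>S. S \<subseteq> H \<union> K \<Longrightarrow> f S = f (S \<inter> H) + f (S \<inter> K)"
    and S: "S \<subseteq> H \<union> K"
  shows "is_arg_max f (\<lambda>T. T \<subseteq> H \<union> K) S \<longleftrightarrow>
    is_arg_max f (\<lambda>T. T \<subseteq> H) (S \<inter> H) \<and> is_arg_max f (\<lambda>T. T \<subseteq> K) (S \<inter> K)"
proof
  assume "is_arg_max f (\<lambda>T. T \<subseteq> H \<union> K) S"
  then have max: "f T \<le> f S" if "T \<subseteq> H \<union> K" for T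
    using that by (auto simp: is_arg_max_linorder)
  have "f T \<le> f (S \<inter> H)" if "T \<subseteq> H" for T
  proof -
    have "(T \<union> S \<inter> K) \<inter> H = T" "(T \<union> S \<inter> K) \<inter> K = S \<inter> K"
      using that disj by auto
    then show ?thesis
      using max[of "T \<union> S \<inter> K"] add[of "T \<union> S \<inter> K"] add[OF S] that by auto
  qed
  moreover have "f T \<le> f (S \<inter> K)" if "T \<subseteq> K" for T
  proof -
    have "(S \<inter> H \<union> T) \<inter> H = S \<inter> H" "(S \<inter> H \<union> T) \<inter> K = T"
      using that disj by auto
    then show ?thesis
      using max[of "S \<inter> H \<union> T"] add[of "S \<inter> H \<union> T"] add[OF S] that by auto
  qed
  ultimately show "is_arg_max f (\<lambda>T. T \<subseteq> H) (S \<inter> H) \<and> is_arg_max f (\<lambda>T. T \<subseteq> K) (S \<inter> K)"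
    by (simp add: is_arg_max_linorder)
next
  assume "is_arg_max f (\<lambda>T. T \<subseteq> H) (S \<inter> H) \<and> is_arg_max f (\<lambda>T. T \<subseteq> K) (S \<inter> K)"
  then have "f (T \<inter> H) + f (T \<inter> K) \<le> f (S \<inter> H) + f (S \<inter> K)" for T
    by (intro add_mono) (auto simp: is_arg_max_linorder)
  then show "is_arg_max f (\<lambda>T. T \<subseteq> H \<union> K) S"
    using S by (simp add: is_arg_max_linorder add)
qed

lemma optimal_profit_eq:
  fixes \<theta> :: "real^'n^'n"
  assumes "optimal_assortment \<theta> r M S"
  shows "optimal_profit \<theta> r M = expected_profit \<theta> r S"
  using assms unfolding optimal_profit_def optimal_assortment_def is_arg_max_linorder
  by (intro Max_eqI) auto

lemma optimal_assortment_exists: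
  fixes \<theta> :: "real^'n^'n"
  shows "\<exists>S. optimal_assortment \<theta> r M S"
proof -
  have "optimal_profit \<theta> r M \<in> expected_profit \<theta> r ` Pow M"
    unfolding optimal_profit_def by (intro Max_in) auto
  then obtain S where "S \<subseteq> M" "optimal_profit \<theta> r M = expected_profit \<theta> r S"
    by blast
  moreover have "expected_profit \<theta> r T \<le> optimal_profit \<theta> r M" if "T \<subseteq> M" for T
    unfolding optimal_profit_def using that by (intro Max_ge) auto
  ultimately show ?thesis
    unfolding optimal_assortment_def is_arg_max_linorder by auto
qed

theorem proposition3:
  fixes \<theta> :: "real^'n^'n" and r :: "'n \<Rightarrow> real" and H K :: "'n set"
  assumes "transpose \<theta> = \<theta>"
    and "H \<union> K = UNIV" and "H \<inter> K = {}"
    and "\<And>i j. i \<in> H \<Longrightarrow> j \<in> K \<Longrightarrow> \<theta> $ i $ j = 0"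
  shows "(\<forall>S. expected_profit \<theta> r S =
             expected_profit \<theta> r (S \<inter> H) + expected_profit \<theta> r (S \<inter> K)) \<and>
         optimal_profit \<theta> r UNIV = optimal_profit \<theta> r H + optimal_profit \<theta> r K \<and>
         (\<forall>S. optimal_assortment \<theta> r UNIV S \<longleftrightarrow>
             optimal_assortment \<theta> r H (S \<inter> H) \<and> optimal_assortment \<theta> r K (S \<inter> K))"
proof -
  have KH: "\<theta> $ j $ i = 0" if "i \<in> H" "j \<in> K" for i j
  proof -
    have "\<theta> $ j $ i = transpose \<theta> $ i $ j"
      by (simp add: transpose_def)
    then show ?thesis
      using assms(1) assms(4)[OF that] by simp
  qed
  have additive: "expected_profit \<theta> r S =
      expected_profit \<theta> r (S \<inter> H) + expected_profit \<theta> r (S \<inter> K)" for S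
  proof -
    have "S = S \<inter> H \<union> S \<inter> K"
      using assms(2) by blast
    moreover have "expected_profit \<theta> r (S \<inter> H \<union> S \<inter> K) =
        expected_profit \<theta> r (S \<inter> H) + expected_profit \<theta> r (S \<inter> K)"
      by (rule expected_profit_union) (use assms(3,4) KH in auto)
    ultimately show ?thesis
      by simp
  qed
  have optimal_iff: "optimal_assortment \<theta> r UNIV S \<longleftrightarrow>
      optimal_assortment \<theta> r H (S \<inter> H) \<and> optimal_assortment \<theta> r K (S \<inter> K)" for S
    using is_arg_max_additive_iff[OF assms(3) additive, of S] assms(2)
    by (simp add: optimal_assortment_def)
  obtain S where S: "optimal_assortment \<theta> r UNIV S"
    using optimal_assortment_exists by blast
  then have "optimal_assortment \<theta> r H (S \<inter> H)" "optimal_assortment \<theta> r K (S \<inter> K)"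
    by (simp_all add: optimal_iff)
  then have "optimal_profit \<theta> r UNIV = optimal_profit \<theta> r H + optimal_profit \<theta> r K"
    using S additive[of S] by (simp add: optimal_profit_eq)
  then show ?thesis
    using additive optimal_iff by blast
qed

end
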